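(* A functor $F\colon\mathsf{C}\to\mathsf{D}$ is full and surjective on objects if, and only if, it is a regular epimorphism and Riguet-full (the latter being equivalent to: the Riguet kernel $\mathrm{K}^{\mathrm{r}}(F)$ is a Riguet congruence on $\mathsf{C}$).
   Context: Regular epimorphisms (coequalizers of some parallel pair) are taken in $\mathsf{Cat}$, the category of all $\mathbf{U}$-categories (for a fixed Grothendieck universe $\mathbf{U}$, categories with object set included in $\mathbf{U}$ and hom-sets elements of $\mathbf{U}$) and functors between them. A functor $F\colon\mathsf{C}\to\mathsf{D}$ is Riguet-full if, for all objects $a,a',b,b'$ of $\mathsf{C}$ and every $f\in\mathrm{Hom}_{\mathsf{C}}(a,b)$, if $F(a)=F(a')$ and $F(b)=F(b')$, then there is $f'\in\mathrm{Hom}_{\mathsf{C}}(a',b')$ with $F(f)=F(f')$. The Riguet kernel of $F$ is the pair $\mathrm{K}^{\mathrm{r}}(F)$ with $\mathrm{K}^{\mathrm{r}}(F)^{\mathrm{ob}}=\{(a,a')\mid F(a)=F(a')\}$ and, for $(a,a'),(b,b')\in\mathrm{K}^{\mathrm{r}}(F)^{\mathrm{ob}}$, $\mathrm{K}^{\mathrm{r}}(F)^{\mathrm{fl}}_{\left(\begin{smallmatrix}a&b\\ a'&b'\end{smallmatrix}\right)}=\{(f,f')\in\mathrm{Hom}_{\mathsf{C}}(a,b)\times\mathrm{Hom}_{\mathsf{C}}(a',b')\mid F(f)=F(f')\}$. A Riguet congruence on a category $\mathsf{C}$ is a pair $\Phi=(\Phi^{\mathrm{ob}},\Phi^{\mathrm{fl}})$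 where $\Phi^{\mathrm{ob}}$ is an equivalence relation on $\mathrm{Ob}(\mathsf{C})$ and $\Phi^{\mathrm{fl}}$ assigns to all $(a,a'),(b,b')\in\Phi^{\mathrm{ob}}$ a subset $\Phi^{\mathrm{fl}}_{\left(\begin{smallmatrix}a&b\\ a'&b'\end{smallmatrix}\right)}\subseteq\mathrm{Hom}_{\mathsf{C}}(a,b)\times\mathrm{Hom}_{\mathsf{C}}(a',b')$ such that: (a) if $(a,b)\in\Phi^{\mathrm{ob}}$, then $(\mathrm{id}_a,\mathrm{id}_b)\in\Phi^{\mathrm{fl}}_{\left(\begin{smallmatrix}a&a\\ b&b\end{smallmatrix}\right)}$; (b) if $f\in\mathrm{Hom}_{\mathsf{C}}(a,b)$, then $(f,f)\in\Phi^{\mathrm{fl}}_{\left(\begin{smallmatrix}a&b\\ a&b\end{smallmatrix}\right)}$; (c) if $(f,f')\in\Phi^{\mathrm{fl}}_{\left(\begin{smallmatrix}a&b\\ a'&b'\end{smallmatrix}\right)}$, then $(f',f)\in\Phi^{\mathrm{fl}}_{\left(\begin{smallmatrix}a'&b'\\ a&b\end{smallmatrix}\right)}$; (d) if $(f,f')\in\Phi^{\mathrm{fl}}_{\left(\begin{smallmatrix}a&b\\ a'&b'\end{smallmatrix}\right)}$ and $(f',f'')\in\Phi^{\mathrm{fl}}_{\left(\begin{smallmatrix}a'&b'\\ a''&b''\end{smallmatrix}\right)}$, then $(f,f'')\in\Phi^{\mathrm{fl}}_{\left(\begin{smallmatrix}a&b\\ a''&b''\end{smallmatrix}\right)}$;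 (e) if $(f,f')\in\Phi^{\mathrm{fl}}_{\left(\begin{smallmatrix}a&b\\ a'&b'\end{smallmatrix}\right)}$ and $(g,g')\in\Phi^{\mathrm{fl}}_{\left(\begin{smallmatrix}b&c\\ b'&c'\end{smallmatrix}\right)}$, then $(g\circ f,g'\circ f')\in\Phi^{\mathrm{fl}}_{\left(\begin{smallmatrix}a&c\\ a'&c'\end{smallmatrix}\right)}$; (f) for all $(a,a'),(b,b')\in\Phi^{\mathrm{ob}}$ and $f\in\mathrm{Hom}_{\mathsf{C}}(a,b)$ there is $f'\in\mathrm{Hom}_{\mathsf{C}}(a',b')$ with $(f,f')\in\Phi^{\mathrm{fl}}_{\left(\begin{smallmatrix}a&b\\ a'&b'\end{smallmatrix}\right)}$. *)

theory Defs
  imports Main "HOL-Library.FuncSet"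
begin

text \<open>
  A Grothendieck universe \<open>U\<close> is rendered as a type \<open>'u\<close>, namely the type of its elements.
  As \<open>U\<close> is transitive, every element of \<open>U\<close> is a set of elements of \<open>U\<close>; \<open>elts x\<close> is that set.
  Thus a subset of \<open>U\<close> is any set of type \<open>'u set\<close>, and it is an element of \<open>U\<close> iff it lies in
  the range of \<open>elts\<close>. Neither infinity nor foundation is imposed.
\<close>

locale grothendieck_universe =
  fixes elts :: "'u \<Rightarrow> 'u set"
  assumes extensionality: "inj elts"
    and pairing: "\<exists>z. elts z = {x, y}"
    \<comment> \<open>all subsets of \<open>x\<close> are elements of \<open>U\<close>, and so is the set of these\<close>
    and powerset: "\<exists>p. elts ` elts p = Pow (elts x)"
    and family_union: "\<exists>z. elts z = (\<Union>i\<in>elts I. elts (X i))"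

text \<open>
  The hom-sets of a category are not required to be disjoint; accordingly, composition and the
  action of a functor on morphisms take the objects concerned as arguments: \<open>Comp C a b c g f\<close>
  is \<open>g \<circ> f\<close> for \<open>f \<in> Hom C a b\<close> and \<open>g \<in> Hom C b c\<close>.
\<close>

record 'u cat =
  Ob :: "'u set"
  Hom :: "'u \<Rightarrow> 'u \<Rightarrow> 'u set"
  Idt :: "'u \<Rightarrow> 'u"
  Comp :: "'u \<Rightarrow> 'u \<Rightarrow> 'u \<Rightarrow> 'u \<Rightarrow> 'u \<Rightarrow> 'u"

definition u_category :: "('u \<Rightarrow> 'u set) \<Rightarrow> 'u cat \<Rightarrow> bool" where
  "u_category elts C \<longleftrightarrow>
     (\<forall>a\<in>Ob C. \<forall>b\<in>Ob C. Hom C a b \<in> range elts) \<and>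
     (\<forall>a\<in>Ob C. Idt C a \<in> Hom C a a) \<and>
     (\<forall>a\<in>Ob C. \<forall>b\<in>Ob C. \<forall>c\<in>Ob C. \<forall>f\<in>Hom C a b. \<forall>g\<in>Hom C b c.
        Comp C a b c g f \<in> Hom C a c) \<and>
     (\<forall>a\<in>Ob C. \<forall>b\<in>Ob C. \<forall>f\<in>Hom C a b.
        Comp C a a b f (Idt C a) = f \<and> Comp C a b b (Idt C b) f = f) \<and>
     (\<forall>a\<in>Ob C. \<forall>b\<in>Ob C. \<forall>c\<in>Ob C. \<forall>d\<in>Ob C.
        \<forall>f\<in>Hom C a b. \<forall>g\<in>Hom C b c. \<forall>h\<in>Hom C c d.
          Comp C a c d h (Comp C a b c g f) = Comp C a b d (Comp C b c d h g) f)"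

record 'u func =
  Fob :: "'u \<Rightarrow> 'u"
  Ffl :: "'u \<Rightarrow> 'u \<Rightarrow> 'u \<Rightarrow> 'u"

text \<open>
  Functors are extensional (undefined outside their domain), so that equality of functors with
  given source and target is equality in HOL.
\<close>

definition is_functor :: "'u cat \<Rightarrow> 'u cat \<Rightarrow> 'u func \<Rightarrow> bool" where
  "is_functor C D F \<longleftrightarrow>
     Fob F \<in> Ob C \<rightarrow>\<^sub>E Ob D \<and>
     (\<forall>a\<in>Ob C. \<forall>b\<in>Ob C. Ffl F a b \<in> Hom C a b \<rightarrow>\<^sub>E Hom D (Fob F a) (Fob F b)) \<and>
     (\<forall>a b. a \<notin> Ob C \<or> b \<notin> Ob C \<longrightarrow> Ffl F a b = (\<lambda>_. undefined)) \<and>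
     (\<forall>a\<in>Ob C. Ffl F a a (Idt C a) = Idt D (Fob F a)) \<and>
     (\<forall>a\<in>Ob C. \<forall>b\<in>Ob C. \<forall>c\<in>Ob C. \<forall>f\<in>Hom C a b. \<forall>g\<in>Hom C b c.
        Ffl F a c (Comp C a b c g f) =
          Comp D (Fob F a) (Fob F b) (Fob F c) (Ffl F b c g) (Ffl F a b f))"

text \<open>\<open>func_comp C G F\<close> is \<open>G \<circ> F\<close>, where \<open>C\<close> is the source of \<open>F\<close>.\<close>

definition func_comp :: "'u cat \<Rightarrow> 'u func \<Rightarrow> 'u func \<Rightarrow> 'u func" where
  "func_comp C G F =
     \<lparr>Fob = (\<lambda>a\<in>Ob C. Fob G (Fob F a)),
      Ffl = (\<lambda>a b. if a \<in> Ob C \<and> b \<in> Ob C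
                   then (\<lambda>f\<in>Hom C a b. Ffl G (Fob F a) (Fob F b) (Ffl F a b f))
                   else (\<lambda>_. undefined))\<rparr>"

definition full :: "'u cat \<Rightarrow> 'u cat \<Rightarrow> 'u func \<Rightarrow> bool" where
  "full C D F \<longleftrightarrow>
     (\<forall>a\<in>Ob C. \<forall>b\<in>Ob C. Ffl F a b ` Hom C a b = Hom D (Fob F a) (Fob F b))"

definition surjective_on_objects :: "'u cat \<Rightarrow> 'u cat \<Rightarrow> 'u func \<Rightarrow> bool" where
  "surjective_on_objects C D F \<longleftrightarrow> Fob F ` Ob C = Ob D"

text \<open>\<open>F : C \<rightarrow> D\<close> is a coequalizer in \<open>Cat\<close> of the functors \<open>G, H : P \<rightarrow> C\<close>.\<close>

definition is_coequalizer ::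
    "('u \<Rightarrow> 'u set) \<Rightarrow> 'u cat \<Rightarrow> 'u cat \<Rightarrow> 'u cat \<Rightarrow> 'u func \<Rightarrow> 'u func \<Rightarrow> 'u func \<Rightarrow> bool" where
  "is_coequalizer elts P C D G H F \<longleftrightarrow>
     func_comp P F G = func_comp P F H \<and>
     (\<forall>E K. u_category elts E \<and> is_functor C E K \<and> func_comp P K G = func_comp P K H \<longrightarrow>
        (\<exists>!L. is_functor D E L \<and> func_comp C L F = K))"

definition regular_epi :: "('u \<Rightarrow> 'u set) \<Rightarrow> 'u cat \<Rightarrow> 'u cat \<Rightarrow> 'u func \<Rightarrow> bool" where
  "regular_epi elts C D F \<longleftrightarrow>
     (\<exists>P G H. u_category elts P \<and> is_functor P C G \<and> is_functor P C H \<and>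
        is_coequalizer elts P C D G H F)"

definition riguet_full :: "'u cat \<Rightarrow> 'u func \<Rightarrow> bool" where
  "riguet_full C F \<longleftrightarrow>
     (\<forall>a\<in>Ob C. \<forall>a'\<in>Ob C. \<forall>b\<in>Ob C. \<forall>b'\<in>Ob C. \<forall>f\<in>Hom C a b.
        Fob F a = Fob F a' \<and> Fob F b = Fob F b' \<longrightarrow>
        (\<exists>f'\<in>Hom C a' b'. Ffl F a b f = Ffl F a' b' f'))"

text \<open>
  The second component of a pair \<open>\<Phi>\<close> of the following type has as its value at \<open>a b a' b'\<close> the
  relation between morphisms \<open>a \<rightarrow> b\<close> and morphisms \<open>a' \<rightarrow> b'\<close>; only its values for
  \<open>(a, a')\<close> and \<open>(b, b')\<close> in the first component are meaningful.
\<close>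

type_synonym 'u cat_rel = "'u rel \<times> ('u \<Rightarrow> 'u \<Rightarrow> 'u \<Rightarrow> 'u \<Rightarrow> 'u rel)"

definition riguet_kernel :: "'u cat \<Rightarrow> 'u func \<Rightarrow> 'u cat_rel" where
  "riguet_kernel C F =
     ({(a, a'). a \<in> Ob C \<and> a' \<in> Ob C \<and> Fob F a = Fob F a'},
      \<lambda>a b a' b'. {(f, f'). f \<in> Hom C a b \<and> f' \<in> Hom C a' b' \<and> Ffl F a b f = Ffl F a' b' f'})"

definition riguet_congruence :: "'u cat \<Rightarrow> 'u cat_rel \<Rightarrow> bool" where
  "riguet_congruence C \<Phi> \<longleftrightarrow>
     (let R = fst \<Phi>; S = snd \<Phi> in
        equiv (Ob C) R \<and>
        (\<forall>(a, a')\<in>R. \<forall>(b, b')\<in>R. S a b a' b' \<subseteq> Hom C a b \<times> Hom C a' b') \<and>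
        (\<forall>(a, b)\<in>R. (Idt C a, Idt C b) \<in> S a a b b) \<and>
        (\<forall>a\<in>Ob C. \<forall>b\<in>Ob C. \<forall>f\<in>Hom C a b. (f, f) \<in> S a b a b) \<and>
        (\<forall>(a, a')\<in>R. \<forall>(b, b')\<in>R. \<forall>(f, f')\<in>S a b a' b'. (f', f) \<in> S a' b' a b) \<and>
        (\<forall>a a' a'' b b' b'' f f' f''.
           (a, a') \<in> R \<and> (a', a'') \<in> R \<and> (b, b') \<in> R \<and> (b', b'') \<in> R \<and>
           (f, f') \<in> S a b a' b' \<and> (f', f'') \<in> S a' b' a'' b'' \<longrightarrow>
           (f, f'') \<in> S a b a'' b'') \<and>
        (\<forall>(a, a')\<in>R. \<forall>(b, b')\<in>R. \<forall>(c, c')\<in>R.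
           \<forall>(f, f')\<in>S a b a' b'. \<forall>(g, g')\<in>S b c b' c'.
             (Comp C a b c g f, Comp C a' b' c' g' f') \<in> S a c a' c') \<and>
        (\<forall>(a, a')\<in>R. \<forall>(b, b')\<in>R. \<forall>f\<in>Hom C a b. \<exists>f'\<in>Hom C a' b'. (f, f') \<in> S a b a' b'))"

end

theory Submission imports Defs begin

text \<open>
  Suppose that \<open>F : C \<rightarrow> D\<close> is full and surjective on objects. Then \<open>F\<close> is a quotient of \<open>C\<close>: the
  objects and morphisms of \<open>D\<close> are those of \<open>C\<close> up to the identifications that \<open>F\<close> makes, and
  every functor making these identifications factors uniquely through \<open>F\<close>
  (\<open>full_surjective_factorization\<close>). The category whose objects and morphisms are the pairs
  identified by \<open>F\<close>, that is, the Riguet kernel, has two projections to \<open>C\<close>, and equalizing them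
  means precisely making these identifications. So \<open>F\<close> is a coequalizer of the projections
  (\<open>full_surjective_imp_regular_epi\<close>). The set theory enters only here, in that the pairs must be
  elements of the universe. Riguet-fullness is immediate, since a morphism between images can be
  lifted between any objects over its source and target.

  Conversely, for a Riguet-full \<open>F\<close> the objects and morphisms hit by \<open>F\<close> form a subcategory of \<open>D\<close>
  (\<open>u_category_image_cat\<close>). A coequalizer that factors through a subcategory of its target forces
  this subcategory to be everything, so \<open>F\<close> is surjective on objects and every morphism of \<open>D\<close> is
  hit. Riguet-fullness, applied once more, lifts a morphism \<open>F a \<rightarrow> F b\<close> to one from \<open>a\<close> to \<open>b\<close>
  (\<open>riguet_full_regular_epi_imp_full_surjective\<close>).
\<close>

section \<open>Categories and functors\<close>

lemma u_categoryD:
  assumes "u_category elts C"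
  shows hom_small: "a \<in> Ob C \<Longrightarrow> b \<in> Ob C \<Longrightarrow> Hom C a b \<in> range elts"
    and idt_hom: "a \<in> Ob C \<Longrightarrow> Idt C a \<in> Hom C a a"
    and comp_hom: "\<lbrakk>a \<in> Ob C; b \<in> Ob C; c \<in> Ob C; f \<in> Hom C a b; g \<in> Hom C b c\<rbrakk>
      \<Longrightarrow> Comp C a b c g f \<in> Hom C a c"
    and comp_idt_right: "\<lbrakk>a \<in> Ob C; b \<in> Ob C; f \<in> Hom C a b\<rbrakk> \<Longrightarrow> Comp C a a b f (Idt C a) = f"
    and comp_idt_left: "\<lbrakk>a \<in> Ob C; b \<in> Ob C; f \<in> Hom C a b\<rbrakk> \<Longrightarrow> Comp C a b b (Idt C b) f = f"
    and comp_assoc: "\<lbrakk>a \<in> Ob C; b \<in> Ob C; c \<in> Ob C; d \<in> Ob C;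
        f \<in> Hom C a b; g \<in> Hom C b c; h \<in> Hom C c d\<rbrakk>
      \<Longrightarrow> Comp C a c d h (Comp C a b c g f) = Comp C a b d (Comp C b c d h g) f"
  using assms unfolding u_category_def by simp_all

lemma is_functorD:
  assumes "is_functor C D F"
  shows functor_ob: "a \<in> Ob C \<Longrightarrow> Fob F a \<in> Ob D"
    and functor_hom: "\<lbrakk>a \<in> Ob C; b \<in> Ob C; f \<in> Hom C a b\<rbrakk>
      \<Longrightarrow> Ffl F a b f \<in> Hom D (Fob F a) (Fob F b)"
    and functor_idt: "a \<in> Ob C \<Longrightarrow> Ffl F a a (Idt C a) = Idt D (Fob F a)"
    and functor_comp: "\<lbrakk>a \<in> Ob C; b \<in> Ob C; c \<in> Ob C; f \<in> Hom C a b; g \<in> Hom C b c\<rbrakk>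
      \<Longrightarrow> Ffl F a c (Comp C a b c g f) =
            Comp D (Fob F a) (Fob F b) (Fob F c) (Ffl F b c g) (Ffl F a b f)"
    and functor_ob_undefined: "a \<notin> Ob C \<Longrightarrow> Fob F a = undefined"
    and functor_hom_undefined: "a \<notin> Ob C \<or> b \<notin> Ob C \<or> f \<notin> Hom C a b \<Longrightarrow> Ffl F a b f = undefined"
proof -
  note F = assms[unfolded is_functor_def]
  show "a \<in> Ob C \<Longrightarrow> Fob F a \<in> Ob D" using F by (auto simp: PiE_def Pi_def)
  show "\<lbrakk>a \<in> Ob C; b \<in> Ob C; f \<in> Hom C a b\<rbrakk> \<Longrightarrow> Ffl F a b f \<in> Hom D (Fob F a) (Fob F b)"
    using F by (blast dest: PiE_mem)
  show "a \<notin> Ob C \<Longrightarrow> Fob F a = undefined" using F by (blast dest: PiE_arb)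
  show "a \<notin> Ob C \<or> b \<notin> Ob C \<or> f \<notin> Hom C a b \<Longrightarrow> Ffl F a b f = undefined"
    using F by (cases "a \<in> Ob C \<and> b \<in> Ob C") (auto dest!: PiE_arb)
qed (use assms in \<open>simp_all add: is_functor_def\<close>)

lemma functor_eqI:
  assumes "is_functor C D F" "is_functor C D' G"
    and "\<And>a. a \<in> Ob C \<Longrightarrow> Fob F a = Fob G a"
    and "\<And>a b f. \<lbrakk>a \<in> Ob C; b \<in> Ob C; f \<in> Hom C a b\<rbrakk> \<Longrightarrow> Ffl F a b f = Ffl G a b f"
  shows "F = G"
proof (rule func.equality)
  show "Fob F = Fob G"
    using assms(3) functor_ob_undefined[OF assms(1)] functor_ob_undefined[OF assms(2)]
    by (intro ext) metis
  show "Ffl F = Ffl G"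
    using assms(4) functor_hom_undefined[OF assms(1)] functor_hom_undefined[OF assms(2)]
    by (intro ext) metis
qed simp

lemma func_comp_apply:
  shows Fob_func_comp: "a \<in> Ob C \<Longrightarrow> Fob (func_comp C G F) a = Fob G (Fob F a)"
    and Ffl_func_comp: "\<lbrakk>a \<in> Ob C; b \<in> Ob C; f \<in> Hom C a b\<rbrakk>
      \<Longrightarrow> Ffl (func_comp C G F) a b f = Ffl G (Fob F a) (Fob F b) (Ffl F a b f)"
  by (simp_all add: func_comp_def)

lemma is_functor_func_comp:
  assumes C: "u_category elts C" and F: "is_functor C D F" and G: "is_functor D E G"
  shows "is_functor C E (func_comp C G F)"
  unfolding is_functor_def using functor_ob[OF F] functor_ob[OF G]
  by (auto simp: func_comp_def functor_hom[OF F] functor_hom[OF G] functor_idt[OF F]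
      functor_idt[OF G] functor_comp[OF F] functor_comp[OF G] idt_hom[OF C] comp_hom[OF C])

text \<open>Equality of composites can be tested pointwise because composites are extensional.\<close>

lemma func_comp_eqI:
  assumes "\<And>a. a \<in> Ob C \<Longrightarrow> Fob G (Fob F a) = Fob G' (Fob F' a)"
    and "\<And>a b f. \<lbrakk>a \<in> Ob C; b \<in> Ob C; f \<in> Hom C a b\<rbrakk>
      \<Longrightarrow> Ffl G (Fob F a) (Fob F b) (Ffl F a b f) = Ffl G' (Fob F' a) (Fob F' b) (Ffl F' a b f)"
  shows "func_comp C G F = func_comp C G' F'"
  using assms by (auto simp: func_comp_def fun_eq_iff)

definition id_functor :: "'u cat \<Rightarrow> 'u func" where
  "id_functor C =
     \<lparr>Fob = (\<lambda>a\<in>Ob C. a),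
      Ffl = (\<lambda>a b. if a \<in> Ob C \<and> b \<in> Ob C then (\<lambda>f\<in>Hom C a b. f) else (\<lambda>_. undefined))\<rparr>"

lemma id_functor_apply:
  shows Fob_id_functor: "a \<in> Ob C \<Longrightarrow> Fob (id_functor C) a = a"
    and Ffl_id_functor: "\<lbrakk>a \<in> Ob C; b \<in> Ob C; f \<in> Hom C a b\<rbrakk> \<Longrightarrow> Ffl (id_functor C) a b f = f"
  by (simp_all add: id_functor_def)

lemma is_functor_id_functor: "u_category elts C \<Longrightarrow> is_functor C C (id_functor C)"
  unfolding is_functor_def by (auto simp: id_functor_def idt_hom comp_hom)

lemma func_comp_id_functor:
  assumes C: "u_category elts C" and D: "u_category elts D" and F: "is_functor C D F"
  shows "func_comp C (id_functor D) F = F"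
  by (rule functor_eqI[OF is_functor_func_comp[OF C F is_functor_id_functor[OF D]] F])
    (auto simp: func_comp_apply id_functor_apply functor_ob[OF F] functor_hom[OF F])


section \<open>Riguet-fullness and the Riguet kernel\<close>

text \<open>
  Every condition on a Riguet congruence except the last holds for the kernel of any functor; the
  last one, for the kernel of \<open>F\<close>, is Riguet-fullness of \<open>F\<close> word for word.
\<close>

lemma riguet_full_iff_kernel_congruence:
  assumes C: "u_category elts C" and F: "is_functor C D F"
  shows "riguet_full C F \<longleftrightarrow> riguet_congruence C (riguet_kernel C F)"
proof
  assume full: "riguet_full C F"
  have eq: "equiv (Ob C) {(a, a'). a \<in> Ob C \<and> a' \<in> Ob C \<and> Fob F a = Fob F a'}"
    by (auto intro!: equivI refl_onI symI transI)
  show "riguet_congruence C (riguet_kernel C F)"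
    unfolding riguet_congruence_def riguet_kernel_def Let_def fst_conv snd_conv
    using full
    by (intro conjI eq)
      (auto simp: idt_hom[OF C] comp_hom[OF C] functor_idt[OF F] functor_comp[OF F]
        riguet_full_def)
next
  assume "riguet_congruence C (riguet_kernel C F)"
  then have "\<forall>(a, a')\<in>fst (riguet_kernel C F). \<forall>(b, b')\<in>fst (riguet_kernel C F).
      \<forall>f\<in>Hom C a b. \<exists>f'\<in>Hom C a' b'. (f, f') \<in> snd (riguet_kernel C F) a b a' b'"
    unfolding riguet_congruence_def Let_def by blast
  then show "riguet_full C F"
    unfolding riguet_full_def riguet_kernel_def by fastforce
qed

lemma full_imp_riguet_full:
  assumes F: "is_functor C D F" and full: "full C D F"
  shows "riguet_full C F"
  unfolding riguet_full_def
proof (intro ballI impI)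
  fix a a' b b' f
  assume ob: "a \<in> Ob C" "a' \<in> Ob C" "b \<in> Ob C" "b' \<in> Ob C" and f: "f \<in> Hom C a b"
    and eq: "Fob F a = Fob F a' \<and> Fob F b = Fob F b'"
  have "Ffl F a b f \<in> Hom D (Fob F a') (Fob F b')"
    using functor_hom[OF F ob(1,3) f] eq by simp
  then show "\<exists>f'\<in>Hom C a' b'. Ffl F a b f = Ffl F a' b' f'"
    using full ob unfolding full_def by (metis imageE)
qed


section \<open>Pairs in a universe\<close>

text \<open>
  The kernel pair of a functor has pairs of objects as objects and sets of pairs of morphisms as
  hom-sets. To be a \<open>U\<close>-category it needs pairs that are elements of \<open>U\<close>, and products of
  elements of \<open>U\<close> must again be elements of \<open>U\<close>. Kuratowski pairs do this. Only the existence of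
  such a pairing \<open>p\<close> with projections \<open>q\<close> and \<open>r\<close> is recorded.
\<close>

lemma (in grothendieck_universe) subset_small:
  assumes "A \<subseteq> B" "B \<in> range elts"
  shows "A \<in> range elts"
proof -
  obtain x where "B = elts x" using assms(2) by blast
  moreover obtain y where "elts ` elts y = Pow (elts x)" using powerset by blast
  ultimately have "A \<in> elts ` elts y" using assms(1) by blast
  then show ?thesis by blast
qed

lemma (in grothendieck_universe) obtain_pairing:
  obtains p q r where "\<And>x y. q (p x y) = x" "\<And>x y. r (p x y) = y"
    "\<And>A B. A \<in> range elts \<Longrightarrow> B \<in> range elts \<Longrightarrow> (\<lambda>(x, y). p x y) ` (A \<times> B) \<in> range elts"
proof -
  obtain u where u: "\<And>x y. elts (u x y) = {x, y}"
    using pairing by metis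
  define p where "p x y = u (u x x) (u x y)" for x y
  have inj: "x = x' \<and> y = y'" if "p x y = p x' y'" for x y x' y'
  proof -
    have "{u x x, u x y} = {u x' x', u x' y'}"
      using that u unfolding p_def by metis
    then have "elts ` {u x x, u x y} = elts ` {u x' x', u x' y'}" by simp
    then have "{{x}, {x, y}} = {{x'}, {x', y'}}" by (simp add: u)
    then show ?thesis by (auto simp: doubleton_eq_iff)
  qed
  define q where "q z = (THE x. \<exists>y. z = p x y)" for z
  define r where "r z = (THE y. \<exists>x. z = p x y)" for z
  have q: "q (p x y) = x" for x y
    unfolding q_def using inj by (intro the_equality) blast+
  have r: "r (p x y) = y" for x y
    unfolding r_def using inj by (intro the_equality) blast+
  have prod: "(\<lambda>(x, y). p x y) ` (A \<times> B) \<in> range elts"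
    if small: "A \<in> range elts" "B \<in> range elts" for A B
  proof -
    obtain X Y where A: "A = elts X" and B: "B = elts Y" using small by blast
    have "\<exists>z. elts z = (\<lambda>y. p x y) ` elts Y" for x
      using family_union[where I = Y and X = "\<lambda>y. u (p x y) (p x y)"]
      by (simp add: u UNION_singleton_eq_range)
    then obtain row where row: "\<And>x. elts (row x) = (\<lambda>y. p x y) ` elts Y" by metis
    obtain z where "elts z = (\<Union>x\<in>elts X. elts (row x))" using family_union by blast
    then have "elts z = (\<lambda>(x, y). p x y) ` (A \<times> B)" by (auto simp: row A B)
    then show ?thesis by (metis rangeI)
  qed
  show thesis using that[OF q r prod] .
qed


section \<open>The kernel pair of a functor\<close>

locale universe_with_pairs = grothendieck_universe elts
  for elts :: "'u \<Rightarrow> 'u set" +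
  fixes p :: "'u \<Rightarrow> 'u \<Rightarrow> 'u" and q r :: "'u \<Rightarrow> 'u"
  assumes q_p [simp]: "q (p x y) = x"
    and r_p [simp]: "r (p x y) = y"
    and product_small:
      "\<lbrakk>A \<in> range elts; B \<in> range elts\<rbrakk> \<Longrightarrow> (\<lambda>(x, y). p x y) ` (A \<times> B) \<in> range elts"
begin

definition kernel_cat :: "'u cat \<Rightarrow> 'u func \<Rightarrow> 'u cat" where
  "kernel_cat C F =
     \<lparr>Ob = (\<lambda>(a, a'). p a a') ` fst (riguet_kernel C F),
      Hom = (\<lambda>x y. (\<lambda>(f, f'). p f f') ` snd (riguet_kernel C F) (q x) (q y) (r x) (r y)),
      Idt = (\<lambda>x. p (Idt C (q x)) (Idt C (r x))),
      Comp = (\<lambda>x y z g f. p (Comp C (q x) (q y) (q z) (q g) (q f))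
                            (Comp C (r x) (r y) (r z) (r g) (r f)))\<rparr>"

text \<open>With \<open>\<pi> = q\<close> and \<open>\<pi> = r\<close> this is the functor to \<open>C\<close> from either side of the kernel pair.\<close>

definition kernel_proj :: "'u cat \<Rightarrow> 'u func \<Rightarrow> ('u \<Rightarrow> 'u) \<Rightarrow> 'u func" where
  "kernel_proj C F \<pi> =
     \<lparr>Fob = (\<lambda>x\<in>Ob (kernel_cat C F). \<pi> x),
      Ffl = (\<lambda>x y. if x \<in> Ob (kernel_cat C F) \<and> y \<in> Ob (kernel_cat C F)
                   then (\<lambda>f\<in>Hom (kernel_cat C F) x y. \<pi> f) else (\<lambda>_. undefined))\<rparr>"

lemma Ob_kernel_cat:
  "x \<in> Ob (kernel_cat C F) \<longleftrightarrow>
     x = p (q x) (r x) \<and> q x \<in> Ob C \<and> r x \<in> Ob C \<and> Fob F (q x) = Fob F (r x)"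
  by (force simp: kernel_cat_def riguet_kernel_def)

lemma Hom_kernel_cat:
  "f \<in> Hom (kernel_cat C F) x y \<longleftrightarrow>
     f = p (q f) (r f) \<and> q f \<in> Hom C (q x) (q y) \<and> r f \<in> Hom C (r x) (r y) \<and>
     Ffl F (q x) (q y) (q f) = Ffl F (r x) (r y) (r f)"
  by (force simp: kernel_cat_def riguet_kernel_def)

lemma Idt_kernel_cat: "Idt (kernel_cat C F) x = p (Idt C (q x)) (Idt C (r x))"
  by (simp add: kernel_cat_def)

lemma Comp_kernel_cat:
  "Comp (kernel_cat C F) x y z g f =
     p (Comp C (q x) (q y) (q z) (q g) (q f)) (Comp C (r x) (r y) (r z) (r g) (r f))"
  by (simp add: kernel_cat_def)

lemmas kernel_cat_simps = Ob_kernel_cat Hom_kernel_cat Idt_kernel_cat Comp_kernel_cat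

lemma u_category_kernel_cat:
  assumes C: "u_category elts C" and F: "is_functor C D F"
  shows "u_category elts (kernel_cat C F)"
proof -
  have "Hom (kernel_cat C F) x y \<in> range elts"
    if "x \<in> Ob (kernel_cat C F)" "y \<in> Ob (kernel_cat C F)" for x y
  proof (rule subset_small)
    show "Hom (kernel_cat C F) x y
        \<subseteq> (\<lambda>(f, f'). p f f') ` (Hom C (q x) (q y) \<times> Hom C (r x) (r y))"
      by (auto simp: kernel_cat_def riguet_kernel_def)
    show "(\<lambda>(f, f'). p f f') ` (Hom C (q x) (q y) \<times> Hom C (r x) (r y)) \<in> range elts"
      using that by (intro product_small hom_small[OF C]) (auto simp: Ob_kernel_cat)
  qed
  then show ?thesis
    unfolding u_category_def
    by (auto simp: kernel_cat_simps idt_hom[OF C] comp_hom[OF C] comp_idt_left[OF C]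
        comp_idt_right[OF C] comp_assoc[OF C] functor_idt[OF F] functor_comp[OF F])
qed

lemma is_functor_kernel_proj:
  assumes C: "u_category elts C" and F: "is_functor C D F" and \<pi>: "\<pi> = q \<or> \<pi> = r"
  shows "is_functor (kernel_cat C F) C (kernel_proj C F \<pi>)"
proof -
  note P = u_category_kernel_cat[OF C F]
  show ?thesis
    unfolding is_functor_def kernel_proj_def using \<pi> idt_hom[OF P] comp_hom[OF P]
    by (auto simp: kernel_cat_simps)
qed

text \<open>
  A functor equalizes the two projections exactly when it makes all the identifications that
  \<open>F\<close> makes.
\<close>

lemma equalizes_kernel_proj_iff:
  "func_comp (kernel_cat C F) K (kernel_proj C F q) =
     func_comp (kernel_cat C F) K (kernel_proj C F r) \<longleftrightarrow>
   (\<forall>a\<in>Ob C. \<forall>a'\<in>Ob C. Fob F a = Fob F a' \<longrightarrow> Fob K a = Fob K a') \<and>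
   (\<forall>a\<in>Ob C. \<forall>a'\<in>Ob C. \<forall>b\<in>Ob C. \<forall>b'\<in>Ob C. \<forall>f\<in>Hom C a b. \<forall>f'\<in>Hom C a' b'.
      Fob F a = Fob F a' \<and> Fob F b = Fob F b' \<and> Ffl F a b f = Ffl F a' b' f' \<longrightarrow>
      Ffl K a b f = Ffl K a' b' f')"
  (is "?L = ?R \<longleftrightarrow> ?ob \<and> ?fl")
proof
  assume eq: "?L = ?R"
  have ?ob
  proof (intro ballI impI)
    fix a a' assume "a \<in> Ob C" "a' \<in> Ob C" "Fob F a = Fob F a'"
    then have x: "p a a' \<in> Ob (kernel_cat C F)" by (simp add: Ob_kernel_cat)
    have "Fob ?L (p a a') = Fob ?R (p a a')" by (simp add: eq)
    then show "Fob K a = Fob K a'" using x by (simp add: func_comp_apply kernel_proj_def)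
  qed
  moreover have ?fl
  proof (intro ballI impI)
    fix a a' b b' f f'
    assume "a \<in> Ob C" "a' \<in> Ob C" "b \<in> Ob C" "b' \<in> Ob C" "f \<in> Hom C a b" "f' \<in> Hom C a' b'"
      "Fob F a = Fob F a' \<and> Fob F b = Fob F b' \<and> Ffl F a b f = Ffl F a' b' f'"
    then have x: "p a a' \<in> Ob (kernel_cat C F)" "p b b' \<in> Ob (kernel_cat C F)"
      "p f f' \<in> Hom (kernel_cat C F) (p a a') (p b b')"
      by (simp_all add: kernel_cat_simps)
    have "Ffl ?L (p a a') (p b b') (p f f') = Ffl ?R (p a a') (p b b') (p f f')" by (simp add: eq)
    then show "Ffl K a b f = Ffl K a' b' f'"
      using x by (simp add: func_comp_apply kernel_proj_def)
  qed
  ultimately show "?ob \<and> ?fl" by blast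
next
  assume "?ob \<and> ?fl"
  then show "?L = ?R"
    by (intro func_comp_eqI) (auto simp: kernel_proj_def kernel_cat_simps)
qed

end


section \<open>Full functors that are surjective on objects are regular epimorphisms\<close>

text \<open>
  A lift of a morphism of \<open>D\<close> can be found between any prescribed lifts of its source and
  target. So one choice of a lift \<open>s d\<close> of every object \<open>d\<close> suffices to define the factorization
  on morphisms, and lifts of composable morphisms between chosen objects compose to a lift of the
  composite. This is where fullness is stronger than surjectivity on morphisms.
\<close>

lemma full_surjective_factorization:
  assumes C: "u_category elts C" and D: "u_category elts D"
    and F: "is_functor C D F" and K: "is_functor C E K"
    and full: "full C D F" and surj: "surjective_on_objects C D F"
    and ob: "\<And>a a'. \<lbrakk>a \<in> Ob C; a' \<in> Ob C; Fob F a = Fob F a'\<rbrakk> \<Longrightarrow> Fob K a = Fob K a'"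
    and fl: "\<And>a a' b b' f f'. \<lbrakk>a \<in> Ob C; a' \<in> Ob C; b \<in> Ob C; b' \<in> Ob C;
      f \<in> Hom C a b; f' \<in> Hom C a' b'; Fob F a = Fob F a'; Fob F b = Fob F b';
      Ffl F a b f = Ffl F a' b' f'\<rbrakk> \<Longrightarrow> Ffl K a b f = Ffl K a' b' f'"
  shows "\<exists>!L. is_functor D E L \<and> func_comp C L F = K"
proof -
  have "\<forall>d\<in>Ob D. \<exists>a. a \<in> Ob C \<and> Fob F a = d"
    using surj unfolding surjective_on_objects_def by force
  then obtain s where s: "\<And>d. d \<in> Ob D \<Longrightarrow> s d \<in> Ob C" and Fs: "\<And>d. d \<in> Ob D \<Longrightarrow> Fob F (s d) = d"
    by metis
  have "\<exists>f. f \<in> Hom C a b \<and> Ffl F a b f = g"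
    if "a \<in> Ob C" "b \<in> Ob C" "g \<in> Hom D (Fob F a) (Fob F b)" for a b g
    using full that unfolding full_def by (metis imageE)
  then have "\<exists>f. f \<in> Hom C (s d) (s e) \<and> Ffl F (s d) (s e) f = g"
    if "d \<in> Ob D" "e \<in> Ob D" "g \<in> Hom D d e" for d e g
    using that s Fs by simp
  then obtain t where t: "\<And>d e g. \<lbrakk>d \<in> Ob D; e \<in> Ob D; g \<in> Hom D d e\<rbrakk> \<Longrightarrow> t d e g \<in> Hom C (s d) (s e)"
    and Ft: "\<And>d e g. \<lbrakk>d \<in> Ob D; e \<in> Ob D; g \<in> Hom D d e\<rbrakk> \<Longrightarrow> Ffl F (s d) (s e) (t d e g) = g"
    by metis
  define L where "L =
    \<lparr>Fob = (\<lambda>d\<in>Ob D. Fob K (s d)),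
     Ffl = (\<lambda>d e. if d \<in> Ob D \<and> e \<in> Ob D
                  then (\<lambda>g\<in>Hom D d e. Ffl K (s d) (s e) (t d e g)) else (\<lambda>_. undefined))\<rparr>"
  have L_ob: "Fob L d = Fob K (s d)" if "d \<in> Ob D" for d
    using that by (simp add: L_def)
  have L_fl: "Ffl L d e g = Ffl K (s d) (s e) (t d e g)"
    if "d \<in> Ob D" "e \<in> Ob D" "g \<in> Hom D d e" for d e g
    using that by (simp add: L_def)
  have L: "is_functor D E L"
    unfolding is_functor_def
  proof (intro conjI ballI allI impI)
    show "Fob L \<in> Ob D \<rightarrow>\<^sub>E Ob E"
      using s functor_ob[OF K] by (auto simp: L_def)
  next
    fix d e assume "d \<in> Ob D" "e \<in> Ob D"
    then show "Ffl L d e \<in> Hom D d e \<rightarrow>\<^sub>E Hom E (Fob L d) (Fob L e)"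
      using s t functor_hom[OF K] by (auto simp: L_def)
  next
    fix d e assume "d \<notin> Ob D \<or> e \<notin> Ob D"
    then show "Ffl L d e = (\<lambda>_. undefined)" by (auto simp: L_def)
  next
    fix d assume d: "d \<in> Ob D"
    have "Ffl K (s d) (s d) (t d d (Idt D d)) = Ffl K (s d) (s d) (Idt C (s d))"
      using d s t Ft Fs idt_hom[OF C] idt_hom[OF D] functor_idt[OF F] by (intro fl) auto
    then show "Ffl L d d (Idt D d) = Idt E (Fob L d)"
      using d s by (simp add: L_ob L_fl idt_hom[OF D] functor_idt[OF K])
  next
    fix d e k g h
    assume dek: "d \<in> Ob D" "e \<in> Ob D" "k \<in> Ob D" and g: "g \<in> Hom D d e" and h: "h \<in> Hom D e k"
    note hg = comp_hom[OF D dek g h]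
    have "Ffl K (s d) (s k) (t d k (Comp D d e k h g))
        = Ffl K (s d) (s k) (Comp C (s d) (s e) (s k) (t e k h) (t d e g))"
      using dek g h hg s t Ft Fs comp_hom[OF C] functor_comp[OF F] by (intro fl) auto
    then show "Ffl L d k (Comp D d e k h g)
        = Comp E (Fob L d) (Fob L e) (Fob L k) (Ffl L e k h) (Ffl L d e g)"
      using dek g h hg s t by (simp add: L_ob L_fl functor_comp[OF K])
  qed
  have "func_comp C L F = K"
  proof (rule functor_eqI[OF is_functor_func_comp[OF C F L] K])
    show "Fob (func_comp C L F) a = Fob K a" if "a \<in> Ob C" for a
      using that s Fs functor_ob[OF F] ob[of "s (Fob F a)" a] by (simp add: func_comp_apply L_ob)
    show "Ffl (func_comp C L F) a b f = Ffl K a b f"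
      if "a \<in> Ob C" "b \<in> Ob C" "f \<in> Hom C a b" for a b f
      using that functor_ob[OF F] functor_hom[OF F] s t Fs Ft
      by (simp add: func_comp_apply L_fl) (intro fl, auto)
  qed
  moreover have "L' = L" if L': "is_functor D E L'" "func_comp C L' F = K" for L'
  proof (rule functor_eqI[OF L'(1) L])
    show "Fob L' d = Fob L d" if "d \<in> Ob D" for d
      using that L'(2) Fob_func_comp[of "s d" C L' F] s Fs by (simp add: L_ob)
    show "Ffl L' d e g = Ffl L d e g" if "d \<in> Ob D" "e \<in> Ob D" "g \<in> Hom D d e" for d e g
      using that L'(2) Ffl_func_comp[of "s d" C "s e" "t d e g" L' F] s t Fs Ft
      by (simp add: L_fl)
  qed
  ultimately show ?thesis using L by blast
qed

lemma full_surjective_imp_regular_epi: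
  assumes U: "grothendieck_universe elts"
    and C: "u_category elts C" and D: "u_category elts D" and F: "is_functor C D F"
    and full: "full C D F" and surj: "surjective_on_objects C D F"
  shows "regular_epi elts C D F"
proof -
  obtain p q r where "universe_with_pairs elts p q r"
    using grothendieck_universe.obtain_pairing[OF U] U
    unfolding universe_with_pairs_def universe_with_pairs_axioms_def by metis
  then interpret universe_with_pairs elts p q r .
  show ?thesis
    unfolding regular_epi_def is_coequalizer_def
  proof (intro exI conjI allI impI)
    show "u_category elts (kernel_cat C F)" by (rule u_category_kernel_cat[OF C F])
    show "is_functor (kernel_cat C F) C (kernel_proj C F q)"
      and "is_functor (kernel_cat C F) C (kernel_proj C F r)"
      by (simp_all add: is_functor_kernel_proj[OF C F])
    show "func_comp (kernel_cat C F) F (kernel_proj C F q)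
        = func_comp (kernel_cat C F) F (kernel_proj C F r)"
      by (simp add: equalizes_kernel_proj_iff)
    fix E K
    assume K: "u_category elts E \<and> is_functor C E K \<and>
      func_comp (kernel_cat C F) K (kernel_proj C F q)
        = func_comp (kernel_cat C F) K (kernel_proj C F r)"
    then have "(\<forall>a\<in>Ob C. \<forall>a'\<in>Ob C. Fob F a = Fob F a' \<longrightarrow> Fob K a = Fob K a') \<and>
      (\<forall>a\<in>Ob C. \<forall>a'\<in>Ob C. \<forall>b\<in>Ob C. \<forall>b'\<in>Ob C. \<forall>f\<in>Hom C a b. \<forall>f'\<in>Hom C a' b'.
        Fob F a = Fob F a' \<and> Fob F b = Fob F b' \<and> Ffl F a b f = Ffl F a' b' f' \<longrightarrow>
        Ffl K a b f = Ffl K a' b' f')"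
      using equalizes_kernel_proj_iff[of C F K] by blast
    then show "\<exists>!L. is_functor D E L \<and> func_comp C L F = K"
      using K by (intro full_surjective_factorization[OF C D F _ full surj]) blast+
  qed
qed


section \<open>Riguet-full regular epimorphisms\<close>

text \<open>
  Morphisms are collected over all pairs of objects above \<open>x\<close> and \<open>y\<close>, so this is the set-theoretic
  image of \<open>F\<close>, which need not be a category.
\<close>

definition image_cat :: "'u cat \<Rightarrow> 'u cat \<Rightarrow> 'u func \<Rightarrow> 'u cat" where
  "image_cat C D F = D\<lparr>
     Ob := Fob F ` Ob C,
     Hom := (\<lambda>x y. {g. \<exists>a\<in>Ob C. \<exists>b\<in>Ob C. Fob F a = x \<and> Fob F b = y \<and> g \<in> Ffl F a b ` Hom C a b})\<rparr>"

lemma image_cat_simps [simp]: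
  "Ob (image_cat C D F) = Fob F ` Ob C"
  "g \<in> Hom (image_cat C D F) x y \<longleftrightarrow>
     (\<exists>a\<in>Ob C. \<exists>b\<in>Ob C. Fob F a = x \<and> Fob F b = y \<and> g \<in> Ffl F a b ` Hom C a b)"
  "Idt (image_cat C D F) = Idt D"
  "Comp (image_cat C D F) = Comp D"
  by (simp_all add: image_cat_def)

lemma Hom_image_cat_subset:
  assumes F: "is_functor C D F"
  shows "Hom (image_cat C D F) x y \<subseteq> Hom D x y"
  using functor_hom[OF F] by auto

text \<open>
  In general the morphisms hit by a functor are not closed under composition: \<open>F f\<close> and \<open>F g\<close>
  may be composable without \<open>f\<close> and \<open>g\<close> being so. Riguet-fullness allows \<open>f\<close> to be moved to any
  other pair of objects over the same source and target, so that morphisms composable in \<open>D\<close>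
  have composable lifts.
\<close>

lemma riguet_full_image_hom:
  assumes "riguet_full C F" "a \<in> Ob C" "b \<in> Ob C"
    and "g \<in> Hom (image_cat C D F) (Fob F a) (Fob F b)"
  obtains f where "f \<in> Hom C a b" "g = Ffl F a b f"
  using assms unfolding riguet_full_def by (auto, metis)

lemma u_category_image_cat:
  assumes U: "grothendieck_universe elts"
    and C: "u_category elts C" and D: "u_category elts D" and F: "is_functor C D F"
    and riguet: "riguet_full C F"
  shows "u_category elts (image_cat C D F)"
  unfolding u_category_def
proof (intro conjI ballI)
  let ?I = "image_cat C D F"
  note sub = Hom_image_cat_subset[OF F, THEN subsetD]
  have ob: "x \<in> Ob D" if "x \<in> Ob ?I" for x
    using that functor_ob[OF F] by auto
  fix x assume x: "x \<in> Ob ?I"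
  then obtain a where a: "a \<in> Ob C" "x = Fob F a" by auto
  then have "Idt D x \<in> Ffl F a a ` Hom C a a"
    using idt_hom[OF C a(1)] functor_idt[OF F a(1)] by (metis imageI)
  then show "Idt ?I x \<in> Hom ?I x x"
    using a by auto
  fix y assume y: "y \<in> Ob ?I"
  show "Hom ?I x y \<in> range elts"
    using grothendieck_universe.subset_small[OF U Hom_image_cat_subset[OF F]] hom_small[OF D] ob x y
    by blast
  {
    fix f assume f: "f \<in> Hom ?I x y"
    show "Comp ?I x x y f (Idt ?I x) = f" "Comp ?I x y y (Idt ?I y) f = f"
      using comp_idt_left[OF D] comp_idt_right[OF D] ob[OF x] ob[OF y] sub[OF f] by simp_all
  }
  fix z assume z: "z \<in> Ob ?I"
  {
    fix f g assume f: "f \<in> Hom ?I x y" and g: "g \<in> Hom ?I y z"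
    obtain a b c where abc: "a \<in> Ob C" "b \<in> Ob C" "c \<in> Ob C"
      and xyz: "x = Fob F a" "y = Fob F b" "z = Fob F c"
      using x y z by auto
    obtain f' where f': "f' \<in> Hom C a b" "f = Ffl F a b f'"
      using riguet_full_image_hom[OF riguet abc(1,2)] f xyz by blast
    obtain g' where g': "g' \<in> Hom C b c" "g = Ffl F b c g'"
      using riguet_full_image_hom[OF riguet abc(2,3)] g xyz by blast
    have "Comp D x y z g f = Ffl F a c (Comp C a b c g' f')"
      using functor_comp[OF F abc f'(1) g'(1)] f' g' xyz by simp
    then show "Comp ?I x y z g f \<in> Hom ?I x z"
      using comp_hom[OF C abc f'(1) g'(1)] abc xyz by auto
  }
  fix w f g h
  assume "w \<in> Ob ?I" "f \<in> Hom ?I x y" "g \<in> Hom ?I y z" "h \<in> Hom ?I z w"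
  then show "Comp ?I x z w h (Comp ?I x y z g f) = Comp ?I x y w (Comp ?I y z w h g) f"
    using comp_assoc[OF D, of x y z w f g h] ob x y z sub by simp
qed

lemma is_functor_image_cat:
  assumes F: "is_functor C D F"
  shows "is_functor C (image_cat C D F) F"
  using F unfolding is_functor_def by (auto simp: PiE_iff)

lemma is_functor_into_supercategory:
  assumes I: "is_functor D I L" and "Ob I \<subseteq> Ob D'" "\<And>x y. Hom I x y \<subseteq> Hom D' x y"
    and "Idt I = Idt D'" "Comp I = Comp D'"
  shows "is_functor D D' L"
  using assms unfolding is_functor_def PiE_iff by (auto; blast)

text \<open>
  \<open>F\<close> is also a functor \<open>C \<rightarrow> image_cat C D F\<close>, and as such it equalizes whatever pair \<open>F\<close>
  coequalizes. The induced functor \<open>L\<close> from \<open>D\<close> to the image satisfies \<open>L \<circ> F = F\<close>. Seen as a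
  functor \<open>D \<rightarrow> D\<close> it is therefore the identity, by uniqueness, and so the image is all of
  \<open>D\<close>.
\<close>

lemma riguet_full_regular_epi_imp_full_surjective:
  assumes U: "grothendieck_universe elts"
    and C: "u_category elts C" and D: "u_category elts D" and F: "is_functor C D F"
    and epi: "regular_epi elts C D F" and riguet: "riguet_full C F"
  shows "full C D F \<and> surjective_on_objects C D F"
proof -
  let ?I = "image_cat C D F"
  obtain P G H where eq: "func_comp P F G = func_comp P F H"
    and univ: "\<And>E K. \<lbrakk>u_category elts E; is_functor C E K; func_comp P K G = func_comp P K H\<rbrakk>
      \<Longrightarrow> \<exists>!L. is_functor D E L \<and> func_comp C L F = K"
    using epi unfolding regular_epi_def is_coequalizer_def by blast
  obtain L where L: "is_functor D ?I L" and LF: "func_comp C L F = F"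
    using univ[OF u_category_image_cat[OF U C D F riguet] is_functor_image_cat[OF F] eq] by blast
  have "is_functor D D L"
    using functor_ob[OF F] Hom_image_cat_subset[OF F]
    by (intro is_functor_into_supercategory[OF L]) auto
  then have L_id: "L = id_functor D"
    using univ[OF D F eq] LF is_functor_id_functor[OF D] func_comp_id_functor[OF C D F] by blast
  have ob: "x \<in> Ob ?I" if "x \<in> Ob D" for x
    using functor_ob[OF L that] that by (simp add: L_id id_functor_apply)
  have hom: "g \<in> Hom ?I x y" if "x \<in> Ob D" "y \<in> Ob D" "g \<in> Hom D x y" for x y g
    using functor_hom[OF L that] unfolding L_id
    using that by (simp only: id_functor_apply)
  have "Ffl F a b ` Hom C a b = Hom D (Fob F a) (Fob F b)" if ab: "a \<in> Ob C" "b \<in> Ob C" for a b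
  proof
    show "Ffl F a b ` Hom C a b \<subseteq> Hom D (Fob F a) (Fob F b)"
      using functor_hom[OF F ab] by blast
    show "Hom D (Fob F a) (Fob F b) \<subseteq> Ffl F a b ` Hom C a b"
      using hom functor_ob[OF F] ab riguet_full_image_hom[OF riguet ab] by blast
  qed
  moreover have "Fob F ` Ob C = Ob D"
    using ob functor_ob[OF F] by auto
  ultimately show ?thesis
    unfolding full_def surjective_on_objects_def by blast
qed

theorem proposition2p22:
  fixes elts :: "'u \<Rightarrow> 'u set"
    and C D :: "'u cat"
    and F :: "'u func"
  assumes "grothendieck_universe elts"
    and "u_category elts C"
    and "u_category elts D"
    and "is_functor C D F"
  shows "(full C D F \<and> surjective_on_objects C D F \<longleftrightarrow>
            regular_epi elts C D F \<and> riguet_full C F) \<and>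
         (riguet_full C F \<longleftrightarrow> riguet_congruence C (riguet_kernel C F))"
  using full_surjective_imp_regular_epi[OF assms] full_imp_riguet_full[OF assms(4)]
    riguet_full_regular_epi_imp_full_surjective[OF assms]
    riguet_full_iff_kernel_congruence[OF assms(2,4)]
  by blast

end
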